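(* Let $k$ be a field of characteristic zero and $N\ge 2$. If the Fomin–Kirillov algebra $\mathcal{E}_N$ is finite-dimensional, then it has a unique element in top degree, up to scale (i.e. its nonzero homogeneous component of highest degree is one-dimensional).
   Context: The Fomin–Kirillov algebra $\mathcal{E}_N$ is the associative unital $k$-algebra generated by $[ij]$, $i\neq j\in\{1,\dots,N\}$, with relations $[ij]=-[ji]$, $[ij]^2=0$, $[ij][km]=[km][ij]$, and $[ij][jk]+[jk][ki]+[ki][ij]=0$ for distinct $i,j,k,m$. It is graded with each $[ij]$ in degree 1. *)

theory Defs
  imports "HOL-Algebra.Embedded_Algebras" "HOL-Algebra.QuotRing" "HOL-Library.Poly_Mapping"
begin

section \<open>Free associative algebras\<close>

text \<open>
  Words over an alphabet, written additively: zero is the empty word and addition is (in general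
  non-commutative) concatenation. With this monoid structure the multiplication that
  \<^theory>\<open>HOL-Library.Poly_Mapping\<close> provides on finitely supported functions (convolution) is the
  multiplication of the free associative algebra.
\<close>

datatype 'a free_word = Word (letters: "'a list")

instantiation free_word :: (type) monoid_add
begin

definition zero_free_word :: "'a free_word"
  where "0 = Word []"

definition plus_free_word :: "'a free_word \<Rightarrow> 'a free_word \<Rightarrow> 'a free_word"
  where "u + v = Word (letters u @ letters v)"

instance
  by standard (simp_all add: zero_free_word_def plus_free_word_def)

end

type_synonym ('g, 'k) nc_poly = "'g free_word \<Rightarrow>\<^sub>0 'k"

definition free_algebra :: "'g set \<Rightarrow> ('g, 'k::field) nc_poly ring"
  where "free_algebra X =
    \<lparr> carrier = {p. \<forall>w \<in> Poly_Mapping.keys p. set (letters w) \<subseteq> X},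
      mult = (*), one = 1, zero = 0, add = (+) \<rparr>"

definition scalar :: "'k::field \<Rightarrow> ('g, 'k) nc_poly"
  where "scalar c = Poly_Mapping.single 0 c"

definition homogeneous :: "nat \<Rightarrow> ('g, 'k::field) nc_poly \<Rightarrow> bool"
  where "homogeneous d p \<longleftrightarrow> (\<forall>w \<in> Poly_Mapping.keys p. length (letters w) = d)"


section \<open>The Fomin--Kirillov algebra\<close>

text \<open>The letter \<open>(i, j)\<close> stands for the generator \<open>[ij]\<close>.\<close>

definition fk_gens :: "nat \<Rightarrow> (nat \<times> nat) set"
  where "fk_gens N = {(i, j). i \<in> {1..N} \<and> j \<in> {1..N} \<and> i \<noteq> j}"

definition br :: "nat \<Rightarrow> nat \<Rightarrow> (nat \<times> nat, 'k::field) nc_poly"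
  where "br i j = Poly_Mapping.single (Word [(i, j)]) 1"

definition fk_relations :: "nat \<Rightarrow> (nat \<times> nat, 'k::field) nc_poly set"
  where "fk_relations N =
      {br i j + br j i | i j. {i, j} \<subseteq> {1..N} \<and> distinct [i, j]}
    \<union> {br i j * br i j | i j. {i, j} \<subseteq> {1..N} \<and> distinct [i, j]}
    \<union> {br i j * br k m - br k m * br i j | i j k m.
         {i, j, k, m} \<subseteq> {1..N} \<and> distinct [i, j, k, m]}
    \<union> {br i j * br j k + br j k * br k i + br k i * br i j | i j k.
         {i, j, k} \<subseteq> {1..N} \<and> distinct [i, j, k]}"

definition fk_ideal :: "nat \<Rightarrow> (nat \<times> nat, 'k::field) nc_poly set"
  where "fk_ideal N = Idl\<^bsub>free_algebra (fk_gens N)\<^esub> (fk_relations N)"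

definition FK :: "nat \<Rightarrow> (nat \<times> nat, 'k::field) nc_poly set ring"
  where "FK N = free_algebra (fk_gens N) Quot fk_ideal N"

definition fk_proj :: "nat \<Rightarrow> (nat \<times> nat, 'k::field) nc_poly \<Rightarrow> (nat \<times> nat, 'k) nc_poly set"
  where "fk_proj N p = fk_ideal N +>\<^bsub>free_algebra (fk_gens N)\<^esub> p"

text \<open>
  The copy of the ground field inside \<^term>\<open>FK N\<close>; dimensions over \<open>k\<close> are dimensions over this
  subfield in the sense of \<^theory>\<open>HOL-Algebra.Embedded_Algebras\<close> (see \<open>subfield_fk_scalars\<close> below).
\<close>

definition fk_scalars :: "nat \<Rightarrow> (nat \<times> nat, 'k::field) nc_poly set set"
  where "fk_scalars N = fk_proj N ` range scalar"

definition fk_component :: "nat \<Rightarrow> nat \<Rightarrow> (nat \<times> nat, 'k::field) nc_poly set set"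
  where "fk_component N d =
    fk_proj N ` {p \<in> carrier (free_algebra (fk_gens N)). homogeneous d p}"


section \<open>Well-definedness\<close>

lemma ring_free_algebra: "ring (free_algebra X :: ('g, 'k::field) nc_poly ring)"
proof (rule ringI)
  let ?F = "free_algebra X :: ('g, 'k) nc_poly ring"
  show "abelian_group ?F"
  proof (rule abelian_groupI)
    fix x y assume "x \<in> carrier ?F" "y \<in> carrier ?F"
    then show "x \<oplus>\<^bsub>?F\<^esub> y \<in> carrier ?F"
      using Poly_Mapping.keys_add[of x y] by (auto simp: free_algebra_def)
  next
    fix x assume x: "x \<in> carrier ?F"
    show "\<exists>y\<in>carrier ?F. y \<oplus>\<^bsub>?F\<^esub> x = \<zero>\<^bsub>?F\<^esub>"
      by (rule bexI[of _ "- x"]) (use x in \<open>auto simp: free_algebra_def\<close>)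
  qed (auto simp: free_algebra_def add_ac)
  show "monoid ?F"
  proof (rule monoidI)
    fix x y assume "x \<in> carrier ?F" "y \<in> carrier ?F"
    then show "x \<otimes>\<^bsub>?F\<^esub> y \<in> carrier ?F"
      using Poly_Mapping.keys_mult[of x y]
      by (fastforce simp: free_algebra_def plus_free_word_def)
  qed (auto simp: free_algebra_def mult.assoc zero_free_word_def)
qed (auto simp: free_algebra_def algebra_simps)

lemma scalar_in_free_algebra: "scalar c \<in> carrier (free_algebra X)"
  by (auto simp: scalar_def free_algebra_def zero_free_word_def)

lemma subfield_scalars:
  "subfield (range scalar) (free_algebra X :: ('g, 'k::field) nc_poly ring)"
proof -
  let ?F = "free_algebra X :: ('g, 'k) nc_poly ring"
  interpret F: ring ?F by (rule ring_free_algebra)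
  have [simp]: "scalar a + scalar b = (scalar (a + b) :: ('g, 'k) nc_poly)"
    "scalar a * scalar b = (scalar (a * b) :: ('g, 'k) nc_poly)" for a b
    by (simp_all add: scalar_def single_add mult_single)
  have one: "1 = (scalar 1 :: ('g, 'k) nc_poly)" and zero: "0 = (scalar 0 :: ('g, 'k) nc_poly)"
    by (simp_all add: scalar_def)
  have inj: "scalar a = (scalar b :: ('g, 'k) nc_poly) \<longleftrightarrow> a = b" for a b
    by (metis lookup_single_eq scalar_def)
  have "cring (?F\<lparr>carrier := range scalar\<rparr>)"
  proof (rule cringI)
    show "abelian_group (?F\<lparr>carrier := range scalar\<rparr>)"
    proof (rule abelian_groupI)
      fix x assume "x \<in> carrier (?F\<lparr>carrier := range scalar\<rparr>)"
      then obtain a where "x = scalar a" by auto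
      then show "\<exists>y\<in>carrier (?F\<lparr>carrier := range scalar\<rparr>).
          y \<oplus>\<^bsub>?F\<lparr>carrier := range scalar\<rparr>\<^esub> x = \<zero>\<^bsub>?F\<lparr>carrier := range scalar\<rparr>\<^esub>"
        by (intro bexI[of _ "scalar (- a)"]) (auto simp: free_algebra_def zero)
    qed (auto simp: free_algebra_def zero add_ac)
    show "comm_monoid (?F\<lparr>carrier := range scalar\<rparr>)"
      by (rule comm_monoidI) (auto simp: free_algebra_def one mult_ac)
  qed (auto simp: free_algebra_def algebra_simps)
  then have "field (?F\<lparr>carrier := range scalar\<rparr>)"
  proof (rule cring.cring_fieldI2)
    show "\<zero>\<^bsub>?F\<lparr>carrier := range scalar\<rparr>\<^esub> \<noteq> \<one>\<^bsub>?F\<lparr>carrier := range scalar\<rparr>\<^esub>"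
      by (simp add: free_algebra_def)
    fix x assume "x \<in> carrier (?F\<lparr>carrier := range scalar\<rparr>)"
      and "x \<noteq> \<zero>\<^bsub>?F\<lparr>carrier := range scalar\<rparr>\<^esub>"
    then obtain a where "x = scalar a" "a \<noteq> 0"
      by (auto simp: free_algebra_def zero inj)
    then show "\<exists>y\<in>carrier (?F\<lparr>carrier := range scalar\<rparr>).
        x \<otimes>\<^bsub>?F\<lparr>carrier := range scalar\<rparr>\<^esub> y = \<one>\<^bsub>?F\<lparr>carrier := range scalar\<rparr>\<^esub>"
      by (intro bexI[of _ "scalar (inverse a)"]) (auto simp: free_algebra_def one)
  qed
  then show ?thesis
    by (intro F.subfield_iff(1)) (auto simp: scalar_in_free_algebra)
qed

lemma lookup_mult_0:
  fixes p q :: "('g, 'k::field) nc_poly"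
  shows "Poly_Mapping.lookup (p * q) 0 = Poly_Mapping.lookup p 0 * Poly_Mapping.lookup q 0"
proof -
  have word: "(0 = u + v) = (u = 0 \<and> v = 0)" for u v :: "'g free_word"
    by (cases u; cases v) (auto simp: zero_free_word_def plus_free_word_def)
  have "(\<Sum>v. Poly_Mapping.lookup q v when 0 = u + v) = (Poly_Mapping.lookup q 0 when u = 0)" for u
    by (cases "u = 0") (simp_all add: word)
  then show ?thesis
    by (simp add: lookup_mult when_mult mult_when)
qed

lemma br_in_free_algebra:
  "i \<in> {1..N} \<Longrightarrow> j \<in> {1..N} \<Longrightarrow> i \<noteq> j \<Longrightarrow> br i j \<in> carrier (free_algebra (fk_gens N))"
  by (auto simp: br_def free_algebra_def fk_gens_def)

lemma fk_relations_subset: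
  "fk_relations N \<subseteq> (carrier (free_algebra (fk_gens N)) :: (nat \<times> nat, 'k::field) nc_poly set)"
proof -
  let ?F = "free_algebra (fk_gens N) :: (nat \<times> nat, 'k) nc_poly ring"
  interpret F: ring ?F by (rule ring_free_algebra)
  have add: "x + y \<in> carrier ?F" and mult: "x * y \<in> carrier ?F"
    if "x \<in> carrier ?F" "y \<in> carrier ?F" for x y
    using F.add.m_closed[OF that] F.m_closed[OF that] by (auto simp: free_algebra_def)
  have diff: "x - y \<in> carrier ?F" if "x \<in> carrier ?F" "y \<in> carrier ?F" for x y
    using that Poly_Mapping.keys_diff[of x y] by (fastforce simp: free_algebra_def)
  show ?thesis
    unfolding fk_relations_def
    by (auto intro!: add mult diff br_in_free_algebra)
qed

lemma ideal_fk_ideal: "ideal (fk_ideal N) (free_algebra (fk_gens N))"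
  unfolding fk_ideal_def
  by (rule ring.genideal_ideal[OF ring_free_algebra fk_relations_subset])

lemma ring_FK: "ring (FK N)"
  unfolding FK_def by (rule ideal.quotient_is_ring[OF ideal_fk_ideal])

lemma fk_proj_hom: "ring_hom_ring (free_algebra (fk_gens N)) (FK N) (fk_proj N)"
  unfolding FK_def fk_proj_def by (rule ideal.rcos_ring_hom_ring[OF ideal_fk_ideal])

lemma one_notin_fk_ideal: "1 \<notin> (fk_ideal N :: (nat \<times> nat, 'k::field) nc_poly set)"
proof -
  let ?F = "free_algebra (fk_gens N) :: (nat \<times> nat, 'k) nc_poly ring"
  let ?J = "{p \<in> carrier ?F. Poly_Mapping.lookup p 0 = 0}"
  interpret F: ring ?F by (rule ring_free_algebra)
  have "ideal ?J ?F"
  proof (rule idealI[OF F.ring_axioms])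
    show "subgroup ?J (add_monoid ?F)"
    proof (rule F.add.subgroupI)
      fix a assume "a \<in> ?J"
      moreover from this have "\<ominus>\<^bsub>?F\<^esub> a = - a"
        by (intro F.minus_equality) (auto simp: free_algebra_def)
      ultimately show "\<ominus>\<^bsub>?F\<^esub> a \<in> ?J"
        by (auto simp: free_algebra_def)
    next
      fix a b assume "a \<in> ?J" "b \<in> ?J"
      then show "a \<oplus>\<^bsub>?F\<^esub> b \<in> ?J"
        using F.add.m_closed[of a b] by (auto simp: free_algebra_def lookup_add)
    qed (auto simp: free_algebra_def intro!: exI[of _ 0])
  next
    fix a x assume "a \<in> ?J" "x \<in> carrier ?F"
    then show "x \<otimes>\<^bsub>?F\<^esub> a \<in> ?J" "a \<otimes>\<^bsub>?F\<^esub> x \<in> ?J"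
      using F.m_closed[of a x] F.m_closed[of x a]
      by (auto simp: free_algebra_def lookup_mult_0)
  qed
  moreover have "Poly_Mapping.lookup (br i j :: (nat \<times> nat, 'k) nc_poly) 0 = 0" for i j
    by (simp add: br_def lookup_single zero_free_word_def)
  then have "Poly_Mapping.lookup p 0 = 0"
    if "p \<in> fk_relations N" for p :: "(nat \<times> nat, 'k) nc_poly"
    using that by (auto simp: fk_relations_def lookup_add lookup_minus lookup_mult_0)
  then have "fk_relations N \<subseteq> ?J"
    using fk_relations_subset[of N, where 'k = 'k] by blast
  ultimately have "fk_ideal N \<subseteq> ?J"
    unfolding fk_ideal_def by (rule F.genideal_minimal)
  then show ?thesis
    by (auto simp: lookup_one)
qed

lemma FK_nontrivial: "\<one>\<^bsub>FK N\<^esub> \<noteq> \<zero>\<^bsub>(FK N :: (nat \<times> nat, 'k::field) nc_poly set ring)\<^esub>"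
proof
  let ?F = "free_algebra (fk_gens N) :: (nat \<times> nat, 'k) nc_poly ring"
  interpret I: ideal "fk_ideal N" ?F by (rule ideal_fk_ideal)
  assume "\<one>\<^bsub>FK N\<^esub> = \<zero>\<^bsub>(FK N :: (nat \<times> nat, 'k) nc_poly set ring)\<^esub>"
  then have "fk_ideal N +>\<^bsub>?F\<^esub> \<one>\<^bsub>?F\<^esub> = fk_ideal N"
    by (simp add: FK_def FactRing_def)
  then have "\<one>\<^bsub>?F\<^esub> \<in> fk_ideal N"
    using I.a_rcos_self[of "\<one>\<^bsub>?F\<^esub>"] by simp
  then show False
    using one_notin_fk_ideal[of N, where 'k = 'k] by (simp add: free_algebra_def)
qed

lemma subfield_fk_scalars: "subfield (fk_scalars N) (FK N)"
  unfolding fk_scalars_def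
  by (rule ring_hom_ring.img_is_subfield(2)[OF fk_proj_hom subfield_scalars FK_nontrivial])

end

(*
  The Fomin-Kirillov algebra E_N is a braided Hopf algebra: the braided coproduct determined by
  Delta[ij] = [ij] (x) 1 + 1 (x) [ij] descends to E_N because the quadratic relations are primitive
  in the free algebra modulo [ij] + [ji]. Let x be a nonzero element of top degree d and let J be
  the space of all f(x_1) x_2, f a linear functional. Since a x = 0 for each generator a,
  comparing with Delta(a x) = Delta(a) Delta(x) = 0 gives
    a f(t_a x_1) x_2 = - f(a x_1) x_2,
  where t_a is the transposition acting on E_N; as t_a is invertible, J is a left ideal. Choosing f
  of degree d with f(x) = 1 shows that 1 is in J, so J = E_N. But the degree d part of f(x_1) x_2
  is f(1) x, so the component of degree d is spanned by x.
*)

theory Submission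
  imports Defs "HOL-Combinatorics.Transposition"
begin

section \<open>Free algebras\<close>

definition monom_word :: "'g list \<Rightarrow> ('g, 'k::field) nc_poly"
  where "monom_word u = Poly_Mapping.single (Word u) 1"

abbreviation gen :: "'g \<Rightarrow> ('g, 'k::field) nc_poly"
  where "gen a \<equiv> monom_word [a]"

lemma monom_word_Nil: "monom_word [] = 1"
  by (simp add: monom_word_def flip: zero_free_word_def)

lemma monom_word_Cons: "monom_word (a # u) = gen a * monom_word u"
  by (simp add: monom_word_def mult_single plus_free_word_def)

lemma br_eq_gen: "br i j = gen (i, j)"
  by (simp add: br_def monom_word_def)

lemma lookup_scalar_mult [simp]:
  "Poly_Mapping.lookup (scalar c * p) w = c * Poly_Mapping.lookup p w"
  for p :: "('g, 'k::field) nc_poly"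
  by (simp add: scalar_def lookup_mult lookup_single when_mult mult_when)

lemma scalar_0 [simp]: "scalar 0 = 0" and scalar_1 [simp]: "scalar 1 = 1"
  by (simp_all add: scalar_def)

lemma scalar_add: "scalar (b + c) = scalar b + scalar c"
  by (simp add: scalar_def single_add)

lemma scalar_mult: "scalar (b * c) = scalar b * scalar c"
  by (simp add: scalar_def mult_single)

lemma scalar_uminus: "scalar (- c) = - scalar c"
  by (simp add: scalar_def single_uminus)

lemma nc_poly_eq_sum:
  "p = (\<Sum>w\<in>Poly_Mapping.keys p. scalar (Poly_Mapping.lookup p w) * monom_word (letters w))"
proof (rule poly_mapping_eqI)
  fix w
  have "Poly_Mapping.lookup (scalar (Poly_Mapping.lookup p v) * monom_word (letters v)) w =
    (if v = w then Poly_Mapping.lookup p v else 0)" for v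
    by (simp add: monom_word_def lookup_single when_def)
  then show "Poly_Mapping.lookup p w = Poly_Mapping.lookup
      (\<Sum>w\<in>Poly_Mapping.keys p. scalar (Poly_Mapping.lookup p w) * monom_word (letters w)) w"
    by (simp add: lookup_sum in_keys_iff)
qed

text \<open>Every element is a finite combination of words, so an identity that is linear in
  \<open>p\<close> needs checking only on words. The letters are unrestricted here.\<close>

lemma nc_poly_induct [case_names zero monom add]:
  assumes "P 0" "\<And>c u. P (scalar c * monom_word u)" "\<And>p q. P p \<Longrightarrow> P q \<Longrightarrow> P (p + q)"
  shows "P p"
proof -
  have "P (\<Sum>w\<in>A. scalar (Poly_Mapping.lookup p w) * monom_word (letters w))"
    if "finite A" for A using that by (induction A) (auto intro: assms)
  then show ?thesis
    by (metis nc_poly_eq_sum finite_keys)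
qed

lemma scalar_commute: "p * scalar c = scalar c * p" for p :: "('g, 'k::field) nc_poly"
proof (induction p rule: nc_poly_induct)
  case (monom d u)
  show ?case by (simp add: scalar_def monom_word_def mult_single ac_simps)
qed (simp_all add: distrib_left distrib_right)

lemma mult_scalar_left_commute: "p * (scalar c * q) = scalar c * (p * q)"
  for p :: "('g, 'k::field) nc_poly"
  by (metis mult.assoc scalar_commute)

section \<open>Elements over a fixed set of letters\<close>

abbreviation fcarrier :: "'g set \<Rightarrow> ('g, 'k::field) nc_poly set"
  where "fcarrier X \<equiv> carrier (free_algebra X)"

lemma add_in_fcarrier: "p \<in> fcarrier X \<Longrightarrow> q \<in> fcarrier X \<Longrightarrow> p + q \<in> fcarrier X"
  using ring.ring_simprules(1)[OF ring_free_algebra, of p X q] by (simp add: free_algebra_def)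

lemma mult_in_fcarrier: "p \<in> fcarrier X \<Longrightarrow> q \<in> fcarrier X \<Longrightarrow> p * q \<in> fcarrier X"
  using ring.ring_simprules(5)[OF ring_free_algebra, of p X q] by (simp add: free_algebra_def)

lemma gen_in_fcarrier: "a \<in> X \<Longrightarrow> gen a \<in> fcarrier X"
  by (simp add: monom_word_def free_algebra_def)

lemma monom_in_fcarrier: "set u \<subseteq> X \<Longrightarrow> monom_word u \<in> fcarrier X"
  by (simp add: monom_word_def free_algebra_def)

lemma zero_in_fcarrier: "0 \<in> fcarrier X" and one_in_fcarrier: "1 \<in> fcarrier X"
  by (simp_all add: free_algebra_def zero_free_word_def)

lemma diff_in_fcarrier:
  fixes p :: "('g, 'k::field) nc_poly"
  assumes "p \<in> fcarrier X" "q \<in> fcarrier X" shows "p - q \<in> fcarrier X"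
  using assms keys_diff[of p q] by (fastforce simp: free_algebra_def)

lemmas fcarrier_intros = add_in_fcarrier mult_in_fcarrier gen_in_fcarrier monom_in_fcarrier
  zero_in_fcarrier one_in_fcarrier diff_in_fcarrier scalar_in_free_algebra

lemma fcarrier_word_induct [consumes 1, case_names zero monom add]:
  assumes "p \<in> fcarrier X" and "P 0"
    and "\<And>c u. set u \<subseteq> X \<Longrightarrow> P (scalar c * monom_word u)"
    and "\<And>p q. p \<in> fcarrier X \<Longrightarrow> q \<in> fcarrier X \<Longrightarrow> P p \<Longrightarrow> P q \<Longrightarrow> P (p + q)"
  shows "P p"
proof -
  let ?s = "\<lambda>A. (\<Sum>w\<in>A. scalar (Poly_Mapping.lookup p w) * monom_word (letters w))"
  \<comment> \<open>Membership of the partial sums is carried along because the sum rule for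
    \<open>P\<close> applies only inside the carrier.\<close>
  have "?s A \<in> fcarrier X \<and> P (?s A)"
    if "finite A" "A \<subseteq> Poly_Mapping.keys p" for A using that
  proof (induction A)
    case (insert w A)
    then have "set (letters w) \<subseteq> X"
      using assms(1) by (auto simp: free_algebra_def)
    with insert show ?case
      by (auto intro!: assms fcarrier_intros)
  qed (auto intro: assms fcarrier_intros)
  then show ?thesis
    by (metis nc_poly_eq_sum finite_keys order_refl)
qed

text \<open>A word arises from the empty word by prepending letters, and scalars are central, so a
  coefficient can be moved past each letter. Peeling off the first letter matches the recursion
  behind \<open>coact\<close>.\<close>

lemma fcarrier_induct [consumes 1, case_names scalar gen add]:
  assumes "p \<in> fcarrier X"
    and scalar: "\<And>c. P (scalar c)"
    and gen: "\<And>a p. a \<in> X \<Longrightarrow> p \<in> fcarrier X \<Longrightarrow> P p \<Longrightarrow> P (gen a * p)"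
    and "\<And>p q. p \<in> fcarrier X \<Longrightarrow> q \<in> fcarrier X \<Longrightarrow> P p \<Longrightarrow> P q \<Longrightarrow> P (p + q)"
  shows "P p"
  using assms(1)
proof (induction p rule: fcarrier_word_induct)
  case zero then show ?case using scalar[of 0] by simp
next
  case (monom c u)
  then show ?case
  proof (induction u)
    case Nil then show ?case using scalar[of c] by (simp add: monom_word_Nil)
  next
    case (Cons a u)
    then have "P (gen a * (scalar c * monom_word u))"
      by (intro gen) (auto intro!: fcarrier_intros)
    then show ?case
      by (simp add: monom_word_Cons[of a u] mult_scalar_left_commute)
  qed
qed (use assms in blast)

section \<open>Linear maps given by their values on words\<close>

definition lin_ext :: "('g list \<Rightarrow> ('h, 'k::field) nc_poly) \<Rightarrow> ('g, 'k) nc_poly \<Rightarrow> ('h, 'k) nc_poly"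
  where "lin_ext g p =
    (\<Sum>w\<in>Poly_Mapping.keys p. scalar (Poly_Mapping.lookup p w) * g (letters w))"

text \<open>The support of a sum can be smaller than the union of the supports. Summing over any
  larger finite set gives all terms of a linear identity the same index set.\<close>

lemma lin_ext_superset:
  assumes "finite A" "Poly_Mapping.keys p \<subseteq> A"
  shows "lin_ext g p = (\<Sum>w\<in>A. scalar (Poly_Mapping.lookup p w) * g (letters w))"
  unfolding lin_ext_def
  by (rule sum.mono_neutral_left) (use assms in \<open>auto simp: in_keys_iff\<close>)

lemma lin_ext_add [simp]: "lin_ext g (p + q) = lin_ext g p + lin_ext g q"
proof -
  let ?A = "Poly_Mapping.keys p \<union> Poly_Mapping.keys q"
  have "Poly_Mapping.keys (p + q) \<subseteq> ?A" by (rule keys_add)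
  then show ?thesis
    by (simp add: lin_ext_superset[of ?A] lookup_add scalar_add distrib_right sum.distrib)
qed

lemma lin_ext_scalar_mult [simp]: "lin_ext g (scalar c * p) = scalar c * lin_ext g p"
proof -
  have "Poly_Mapping.keys (scalar c * p) \<subseteq> Poly_Mapping.keys p"
    by (auto simp: in_keys_iff)
  then show ?thesis
    by (simp add: lin_ext_superset[of "Poly_Mapping.keys p"] scalar_mult sum_distrib_left mult.assoc)
qed

lemma lin_ext_monom [simp]: "lin_ext g (monom_word u) = g u"
  by (simp add: lin_ext_def monom_word_def)

lemma lin_ext_0 [simp]: "lin_ext g 0 = 0"
  by (simp add: lin_ext_def)

lemma lin_ext_1 [simp]: "lin_ext g 1 = g []"
  by (metis lin_ext_monom monom_word_Nil)

lemma lin_ext_scalar [simp]: "lin_ext g (scalar c) = scalar c * g []"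
  using lin_ext_scalar_mult[of g c 1] by simp

lemma lin_ext_diff [simp]: "lin_ext g (p - q) = lin_ext g p - lin_ext g q"
  using lin_ext_add[of g "p - q" q] by simp

text \<open>The projection onto degree \<open>n\<close>. It turns homogeneity into the equation
  \<open>hpart n p = p\<close>, to which linear arguments apply.\<close>

definition hpart :: "nat \<Rightarrow> ('g, 'k::field) nc_poly \<Rightarrow> ('g, 'k) nc_poly"
  where "hpart n = lin_ext (\<lambda>u. if length u = n then monom_word u else 0)"

lemma hpart_simps [simp]:
  "hpart n 0 = 0" "hpart n (p + q) = hpart n p + hpart n q"
  "hpart n (p - q) = hpart n p - hpart n q"
  "hpart n (scalar c * p) = scalar c * hpart n p"
  "hpart n (monom_word u) = (if length u = n then monom_word u else 0)"
  "hpart n (scalar c) = (if n = 0 then scalar c else 0)"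
  by (simp_all add: hpart_def monom_word_Nil)

lemma hpart_gen_mult [simp]:
  "hpart 0 (gen a * p) = 0" "hpart (Suc n) (gen a * p) = gen a * hpart n p"
  by (induction p rule: nc_poly_induct)
     (simp_all add: distrib_left mult_scalar_left_commute flip: monom_word_Cons)

lemma lookup_hpart:
  fixes p :: "('a, 'k::field) nc_poly"
  shows "Poly_Mapping.lookup (hpart n p) w =
    (if length (letters w) = n then Poly_Mapping.lookup p w else 0)"
proof (induction p rule: nc_poly_induct)
  case (monom c u)
  have "Poly_Mapping.lookup (monom_word u :: ('a, 'k) nc_poly) w = (if w = Word u then 1 else 0)"
    for w :: "'a free_word"
    by (simp add: monom_word_def lookup_single when_def)
  then show ?case by (cases w) auto
qed (simp_all add: lookup_add)

lemma homogeneous_iff_hpart: "homogeneous n p \<longleftrightarrow> hpart n p = p"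
proof
  assume "homogeneous n p"
  then show "hpart n p = p"
    by (intro poly_mapping_eqI) (auto simp: lookup_hpart homogeneous_def in_keys_iff)
next
  assume "hpart n p = p"
  then have "length (letters w) = n" if "Poly_Mapping.lookup p w \<noteq> 0" for w
    using that by (metis lookup_hpart)
  then show "homogeneous n p"
    by (auto simp: homogeneous_def in_keys_iff)
qed

lemma hpart_in_fcarrier: "p \<in> fcarrier X \<Longrightarrow> hpart n p \<in> fcarrier X"
  by (auto simp: free_algebra_def in_keys_iff lookup_hpart split: if_splits)

text \<open>The algebra homomorphism induced by a relabelling of the letters; transpositions of
  indices will act through it.\<close>

definition subst :: "('g \<Rightarrow> 'h) \<Rightarrow> ('g, 'k::field) nc_poly \<Rightarrow> ('h, 'k) nc_poly"
  where "subst \<sigma> = lin_ext (\<lambda>u. monom_word (map \<sigma> u))"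

lemma subst_simps [simp]:
  "subst \<sigma> 0 = 0" "subst \<sigma> 1 = 1" "subst \<sigma> (p + q) = subst \<sigma> p + subst \<sigma> q"
  "subst \<sigma> (p - q) = subst \<sigma> p - subst \<sigma> q"
  "subst \<sigma> (scalar c * p) = scalar c * subst \<sigma> p" "subst \<sigma> (scalar c) = scalar c"
  "subst \<sigma> (monom_word u) = monom_word (map \<sigma> u)"
  by (simp_all add: subst_def monom_word_Nil)

lemma subst_gen_mult [simp]: "subst \<sigma> (gen a * p) = gen (\<sigma> a) * subst \<sigma> p"
proof (induction p rule: nc_poly_induct)
  case (monom c u)
  then show ?case
    by (simp add: mult_scalar_left_commute flip: monom_word_Cons)
qed (simp_all add: distrib_left)

lemma subst_subst [simp]: "subst \<sigma> (subst \<tau> p) = subst (\<sigma> \<circ> \<tau>) p"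
  by (induction p rule: nc_poly_induct) (simp_all add: comp_def)

lemma subst_id: "(\<And>a. \<sigma> a = a) \<Longrightarrow> subst \<sigma> p = p"
  by (induction p rule: nc_poly_induct) (simp_all add: map_idI)

lemma subst_in_fcarrier:
  assumes "p \<in> fcarrier X" "\<sigma> ` X \<subseteq> Y" shows "subst \<sigma> p \<in> fcarrier Y"
  using assms(1)
proof (induction p rule: fcarrier_induct)
  case (gen a p)
  with assms(2) show ?case by (auto intro!: fcarrier_intros)
qed (use assms(2) in \<open>auto intro!: fcarrier_intros\<close>)

section \<open>The ideal of relations\<close>

abbreviation fk_carrier :: "nat \<Rightarrow> (nat \<times> nat, 'k::field) nc_poly set"
  where "fk_carrier N \<equiv> fcarrier (fk_gens N)"

lemma add_in_fk_ideal: "p \<in> fk_ideal N \<Longrightarrow> q \<in> fk_ideal N \<Longrightarrow> p + q \<in> fk_ideal N"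
  using additive_subgroup.a_closed[OF ideal.axioms(1)[OF ideal_fk_ideal], of p N q]
  by (simp add: free_algebra_def)

lemma zero_in_fk_ideal: "0 \<in> fk_ideal N"
  using additive_subgroup.zero_closed[OF ideal.axioms(1)[OF ideal_fk_ideal], of N]
  by (simp add: free_algebra_def)

lemma mult_left_in_fk_ideal: "p \<in> fk_ideal N \<Longrightarrow> q \<in> fk_carrier N \<Longrightarrow> q * p \<in> fk_ideal N"
  using ideal.I_l_closed[OF ideal_fk_ideal, of p N q] by (simp add: free_algebra_def)

lemma mult_right_in_fk_ideal: "p \<in> fk_ideal N \<Longrightarrow> q \<in> fk_carrier N \<Longrightarrow> p * q \<in> fk_ideal N"
  using ideal.I_r_closed[OF ideal_fk_ideal, of p N q] by (simp add: free_algebra_def)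

lemma fk_relations_in_fk_ideal: "fk_relations N \<subseteq> fk_ideal N"
  unfolding fk_ideal_def
  by (rule ring.genideal_self[OF ring_free_algebra fk_relations_subset])

text \<open>The ideal is the least one containing the relations, so it lies in any ideal whose
  members satisfy \<open>P\<close>. Only the relations carry a right factor; left factors are
  reached one generator at a time, as suits maps defined by recursion on the first letter.\<close>

lemma fk_ideal_induct [consumes 1, case_names zero relation scalar gen add]:
  fixes p :: "(nat \<times> nat, 'k::field) nc_poly"
  assumes "p \<in> fk_ideal N" and "P 0"
    and rel: "\<And>r v. r \<in> fk_relations N \<Longrightarrow> v \<in> fk_carrier N \<Longrightarrow> P (r * v)"
    and scalar: "\<And>c p. p \<in> fk_carrier N \<Longrightarrow> P p \<Longrightarrow> P (scalar c * p)"
    and gen: "\<And>a p. a \<in> fk_gens N \<Longrightarrow> p \<in> fk_carrier N \<Longrightarrow> P p \<Longrightarrow> P (gen a * p)"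
    and add: "\<And>p q. P p \<Longrightarrow> P q \<Longrightarrow> P (p + q)"
  shows "P p"
proof -
  let ?F = "free_algebra (fk_gens N) :: (nat \<times> nat, 'k) nc_poly ring"
  \<comment> \<open>quantifying over the right factor makes right closure automatic\<close>
  let ?J = "{p \<in> carrier ?F. \<forall>v \<in> carrier ?F. P (p * v)}"
  interpret F: ring ?F by (rule ring_free_algebra)
  \<comment> \<open>Induction on the left factor reduces it to scalars, single generators and
    sums.\<close>
  have left: "P (x * p)" if "x \<in> carrier ?F" "p \<in> carrier ?F" "P p" for x p
    using that
    by (induction x rule: fcarrier_induct)
       (auto simp: mult.assoc distrib_right intro!: scalar gen add fcarrier_intros)
  have minus: "\<ominus>\<^bsub>?F\<^esub> p = scalar (- 1) * p" if "p \<in> carrier ?F" for p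
  proof (rule F.minus_equality)
    show "scalar (- 1) * p \<in> carrier ?F"
      using that by (intro fcarrier_intros)
  qed (use that in \<open>auto simp: free_algebra_def scalar_uminus\<close>)
  have "ideal ?J ?F"
  proof (rule idealI[OF F.ring_axioms])
    show "subgroup ?J (add_monoid ?F)"
    proof (rule F.add.subgroupI)
      fix p assume "p \<in> ?J"
      then show "\<ominus>\<^bsub>?F\<^esub> p \<in> ?J"
        by (auto simp: minus mult.assoc intro!: scalar fcarrier_intros)
    next
      fix p q assume "p \<in> ?J" "q \<in> ?J"
      then have "p + q \<in> ?J"
        by (auto simp: distrib_right intro!: add fcarrier_intros)
      then show "p \<oplus>\<^bsub>?F\<^esub> q \<in> ?J" by (simp add: free_algebra_def)
    qed (use \<open>P 0\<close> in \<open>auto intro!: exI[of _ 0] zero_in_fcarrier\<close>)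
  next
    fix p x assume p: "p \<in> ?J" and x: "x \<in> carrier ?F"
    have "x * p \<in> ?J" "p * x \<in> ?J"
      using p x by (auto simp: mult.assoc intro: left fcarrier_intros)
    then show "x \<otimes>\<^bsub>?F\<^esub> p \<in> ?J" "p \<otimes>\<^bsub>?F\<^esub> x \<in> ?J"
      by (simp_all add: free_algebra_def)
  qed
  moreover have "fk_relations N \<subseteq> ?J"
    using rel fk_relations_subset[of N, where 'k = 'k] by auto
  ultimately have "fk_ideal N \<subseteq> ?J"
    unfolding fk_ideal_def by (rule F.genideal_minimal)
  \<comment> \<open>The right factor 1 recovers \<open>P p\<close> itself.\<close>
  then show ?thesis
    using assms(1) one_in_fcarrier[of "fk_gens N"] by fastforce
qed

lemma fk_relations_cases [consumes 1, case_names antisym square commute three]: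
  assumes "r \<in> fk_relations N"
  obtains i j where "r = gen (i, j) + gen (j, i)" "{i, j} \<subseteq> {1..N}" "distinct [i, j]"
    | i j where "r = gen (i, j) * gen (i, j)" "{i, j} \<subseteq> {1..N}" "distinct [i, j]"
    | i j k m where "r = gen (i, j) * gen (k, m) - gen (k, m) * gen (i, j)"
        "{i, j, k, m} \<subseteq> {1..N}" "distinct [i, j, k, m]"
    | i j k where "r = gen (i, j) * gen (j, k) + gen (j, k) * gen (k, i) + gen (k, i) * gen (i, j)"
        "{i, j, k} \<subseteq> {1..N}" "distinct [i, j, k]"
  using assms unfolding fk_relations_def br_eq_gen
  by - (elim UnE CollectE exE conjE; erule (2) that)

lemma fk_relationsI:
  "\<lbrakk>{i, j} \<subseteq> {1..N}; distinct [i, j]\<rbrakk> \<Longrightarrow> gen (i, j) + gen (j, i) \<in> fk_relations N"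
  "\<lbrakk>{i, j} \<subseteq> {1..N}; distinct [i, j]\<rbrakk> \<Longrightarrow> gen (i, j) * gen (i, j) \<in> fk_relations N"
  "\<lbrakk>{i, j, k, m} \<subseteq> {1..N}; distinct [i, j, k, m]\<rbrakk> \<Longrightarrow>
    gen (i, j) * gen (k, m) - gen (k, m) * gen (i, j) \<in> fk_relations N"
  "\<lbrakk>{i, j, k} \<subseteq> {1..N}; distinct [i, j, k]\<rbrakk> \<Longrightarrow>
    gen (i, j) * gen (j, k) + gen (j, k) * gen (k, i) + gen (k, i) * gen (i, j) \<in> fk_relations N"
proof -
  note intros = CollectI exI conjI
  show "\<lbrakk>{i, j} \<subseteq> {1..N}; distinct [i, j]\<rbrakk> \<Longrightarrow> gen (i, j) + gen (j, i) \<in> fk_relations N"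
    unfolding fk_relations_def br_eq_gen by (rule UnI1, rule UnI1, rule UnI1, intro intros, rule refl)
  show "\<lbrakk>{i, j} \<subseteq> {1..N}; distinct [i, j]\<rbrakk> \<Longrightarrow> gen (i, j) * gen (i, j) \<in> fk_relations N"
    unfolding fk_relations_def br_eq_gen by (rule UnI1, rule UnI1, rule UnI2, intro intros, rule refl)
  show "\<lbrakk>{i, j, k, m} \<subseteq> {1..N}; distinct [i, j, k, m]\<rbrakk> \<Longrightarrow>
      gen (i, j) * gen (k, m) - gen (k, m) * gen (i, j) \<in> fk_relations N"
    unfolding fk_relations_def br_eq_gen by (rule UnI1, rule UnI2, intro intros, rule refl)
  show "\<lbrakk>{i, j, k} \<subseteq> {1..N}; distinct [i, j, k]\<rbrakk> \<Longrightarrow>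
      gen (i, j) * gen (j, k) + gen (j, k) * gen (k, i) + gen (k, i) * gen (i, j) \<in> fk_relations N"
    unfolding fk_relations_def br_eq_gen by (rule UnI2, intro intros, rule refl)
qed

lemma fk_ideal_gen_antisym:
  assumes "{i, j} \<subseteq> {1..N}" "distinct [i, j]" "p \<in> fk_carrier N"
  shows "gen (i, j) * p + gen (j, i) * p \<in> fk_ideal N"
proof -
  have "(gen (i, j) + gen (j, i)) * p \<in> fk_ideal N"
    using fk_relationsI(1)[OF assms(1,2)] fk_relations_in_fk_ideal assms(3)
    by (blast intro: mult_right_in_fk_ideal)
  then show ?thesis by (simp add: distrib_right)
qed

text \<open>The ideal is graded because each relation is homogeneous: the degree \<open>n\<close>
  part of \<open>r * v\<close> is \<open>r\<close> times a homogeneous part of \<open>v\<close>, or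
  zero if \<open>n\<close> is below the degree of \<open>r\<close>.\<close>

lemma hpart_in_fk_ideal:
  assumes "p \<in> fk_ideal N" shows "hpart n p \<in> fk_ideal N"
  using assms
proof (induction p arbitrary: n rule: fk_ideal_induct)
  case (relation r v)
  have r: "r * hpart m v \<in> fk_ideal N" for m
    using relation fk_relations_in_fk_ideal
    by (blast intro: mult_right_in_fk_ideal hpart_in_fcarrier)
  \<comment> \<open>Multiplication by a quadratic relation raises the degree by two, so nothing is
    left in degrees 0 and 1.\<close>
  consider "n = 0" | "n = 1" | m where "n = Suc (Suc m)"
    by (metis One_nat_def not0_implies_Suc)
  note n = this
  from relation(1) show ?case
  proof (cases rule: fk_relations_cases)
    case (antisym i j)
    then show ?thesis
      using r[of "n - 1"] by (cases n) (simp_all add: distrib_right zero_in_fk_ideal)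
  next
    case (square i j)
    from n show ?thesis
      by cases (use r square in \<open>simp_all add: mult.assoc zero_in_fk_ideal\<close>)
  next
    case (commute i j k m)
    from n show ?thesis
      by cases (use r commute in \<open>simp_all add: mult.assoc left_diff_distrib zero_in_fk_ideal\<close>)
  next
    case (three i j k)
    from n show ?thesis
      by cases (use r three in \<open>simp_all add: mult.assoc distrib_right zero_in_fk_ideal\<close>)
  qed
next
  case (gen a p)
  then show ?case
    by (cases n) (auto intro!: mult_left_in_fk_ideal zero_in_fk_ideal gen_in_fcarrier)
qed (simp_all add: zero_in_fk_ideal add_in_fk_ideal mult_left_in_fk_ideal scalar_in_free_algebra)

text \<open>The transposition of the two indices of \<open>a\<close>, acting on generators. No sign
  is inserted: \<open>a = (i, j)\<close> goes to \<open>(j, i)\<close>, which represents the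
  negative of \<open>a\<close> in the quotient.\<close>

abbreviation tr :: "nat \<times> nat \<Rightarrow> nat \<times> nat \<Rightarrow> nat \<times> nat"
  where "tr a \<equiv> map_prod (transpose (fst a) (snd a)) (transpose (fst a) (snd a))"

lemma map_prod_transpose_fk_gens:
  assumes "i \<in> {1..N}" "j \<in> {1..N}"
  shows "map_prod (transpose i j) (transpose i j) ` fk_gens N \<subseteq> fk_gens N"
proof -
  have "transpose i j x \<in> {1..N}" if "x \<in> {1..N}" for x
    using that assms by (simp add: transpose_def)
  then show ?thesis
    unfolding fk_gens_def by (auto simp del: atLeastAtMost_iff dest: transpose_eq_imp_eq)
qed

lemma tr_in_fcarrier:
  assumes "a \<in> fk_gens N" "p \<in> fk_carrier N" shows "subst (tr a) p \<in> fk_carrier N"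
  using assms by (intro subst_in_fcarrier[OF assms(2)] map_prod_transpose_fk_gens)
    (auto simp: fk_gens_def)

text \<open>A transposition permutes the indices from 1 to \<open>N\<close>, hence sends each
  relation to a relation of the same kind.\<close>

lemma tr_in_fk_ideal:
  assumes "a \<in> fk_gens N" "p \<in> fk_ideal N" shows "subst (tr a) p \<in> fk_ideal N"
  using assms(2)
proof (induction p rule: fk_ideal_induct)
  case (relation r v)
  define s where "s = transpose (fst a) (snd a)"
  have tr: "tr a = map_prod s s" by (simp add: s_def)
  have s: "s i \<in> {1..N} \<longleftrightarrow> i \<in> {1..N}" "s i = s j \<longleftrightarrow> i = j" for i j
    using assms(1) by (auto simp: fk_gens_def s_def transpose_def split: if_splits)
  have r: "r * subst (tr a) v \<in> fk_ideal N" if "r \<in> fk_relations N" for r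
    using that relation assms(1) fk_relations_in_fk_ideal
    by (blast intro: mult_right_in_fk_ideal tr_in_fcarrier)
  from relation(1) show ?case
  proof (cases rule: fk_relations_cases)
    case (antisym i j)
    then show ?thesis
      using r[OF fk_relationsI(1)[of "s i" "s j"]] s by (simp add: distrib_right tr)
  next
    case (square i j)
    then show ?thesis
      using r[OF fk_relationsI(2)[of "s i" "s j"]] s by (simp add: mult.assoc tr)
  next
    case (commute i j k m)
    then show ?thesis
      using r[OF fk_relationsI(3)[of "s i" "s j" "s k" "s m"]] s
      by (simp add: mult.assoc left_diff_distrib tr)
  next
    case (three i j k)
    then show ?thesis
      using r[OF fk_relationsI(4)[of "s i" "s j" "s k"]] s
      by (simp add: mult.assoc distrib_right tr)
  qed
next
  case (gen b p)
  have "fst a \<in> {1..N}" "snd a \<in> {1..N}"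
    using assms(1) by (auto simp: fk_gens_def)
  then have "tr a b \<in> fk_gens N"
    using map_prod_transpose_fk_gens[of "fst a" N "snd a"] gen(1) by blast
  then have "gen (tr a b) \<in> fk_carrier N"
    by (rule gen_in_fcarrier)
  with gen show ?case
    unfolding subst_gen_mult by (blast intro: mult_left_in_fk_ideal)
qed (simp_all add: zero_in_fk_ideal add_in_fk_ideal mult_left_in_fk_ideal scalar_in_free_algebra)

section \<open>The braided coproduct\<close>

text \<open>
  \<open>coact f p\<close> is \<open>f(p\<^sub>1) p\<^sub>2\<close> for the braided coproduct, computed from
  \<open>\<Delta>(a u) = (a \<otimes> 1 + 1 \<otimes> a) \<Delta>(u)\<close>, where moving the letter \<open>a\<close> past the first tensor
  factor applies its transposition. Letting \<open>f\<close> vary in the recursion avoids tensor products.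
\<close>

primrec coact_word :: "(nat \<times> nat) list \<Rightarrow> ((nat \<times> nat, 'k::field) nc_poly \<Rightarrow> 'k) \<Rightarrow>
    (nat \<times> nat, 'k) nc_poly"
  where
    "coact_word [] f = scalar (f 1)"
  | "coact_word (a # u) f =
      coact_word u (\<lambda>p. f (gen a * p)) + gen a * coact_word u (\<lambda>p. f (subst (tr a) p))"

definition coact :: "((nat \<times> nat, 'k::field) nc_poly \<Rightarrow> 'k) \<Rightarrow>
    (nat \<times> nat, 'k) nc_poly \<Rightarrow> (nat \<times> nat, 'k) nc_poly"
  where "coact f = lin_ext (\<lambda>u. coact_word u f)"

section \<open>Linearity and locality of the coaction\<close>

lemma coact_simps [simp]:
  "coact f 0 = 0" "coact f (p + q) = coact f p + coact f q"
  "coact f (p - q) = coact f p - coact f q" "coact f (scalar c * p) = scalar c * coact f p"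
  "coact f (monom_word u) = coact_word u f" "coact f (scalar c) = scalar (c * f 1)"
  by (simp_all add: coact_def scalar_mult)

lemma coact_gen_mult [simp]: "coact f (gen a * p) =
  coact (\<lambda>q. f (gen a * q)) p + gen a * coact (\<lambda>q. f (subst (tr a) q)) p"
proof (induction p rule: nc_poly_induct)
  case (monom c u)
  then show ?case
    by (simp add: mult_scalar_left_commute distrib_left flip: monom_word_Cons)
qed (simp_all add: distrib_left ac_simps)

text \<open>Linearity in the functional holds for arbitrary functions \<open>f\<close> and
  \<open>g\<close>. The induction on words must leave them arbitrary, since the recursion replaces
  them by translates.\<close>

lemma coact_fun_add: "coact (\<lambda>q. f q + g q) p = coact f p + coact g p"
proof -
  have "coact_word u (\<lambda>q. f q + g q) = coact_word u f + coact_word u g" for u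
    by (induction u arbitrary: f g) (simp_all add: scalar_add algebra_simps)
  then show ?thesis by (induction p rule: nc_poly_induct) (simp_all add: algebra_simps)
qed

lemma coact_fun_scalar: "coact (\<lambda>q. c * f q) p = scalar c * coact f p"
proof -
  have "coact_word u (\<lambda>q. c * f q) = scalar c * coact_word u f" for u
    by (induction u arbitrary: f)
       (simp_all add: scalar_mult mult_scalar_left_commute distrib_left)
  then show ?thesis
    by (induction p rule: nc_poly_induct)
       (simp_all add: distrib_left mult_scalar_left_commute[of "scalar c"])
qed

text \<open>The recursion evaluates \<open>f\<close> only at elements obtained from 1 by left
  multiplication with generators and by transpositions, and these stay in the carrier. So only the
  values of \<open>f\<close> there matter.\<close>

lemma coact_eq_0:
  assumes "p \<in> fk_carrier N" "\<And>q. q \<in> fk_carrier N \<Longrightarrow> f q = 0"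
  shows "coact f p = 0"
  using assms
proof (induction p arbitrary: f rule: fcarrier_induct)
  case (gen a p)
  then show ?case by (simp add: tr_in_fcarrier fcarrier_intros)
qed (simp_all add: one_in_fcarrier)

lemma coact_in_fcarrier: "p \<in> fk_carrier N \<Longrightarrow> coact f p \<in> fk_carrier N"
  by (induction p arbitrary: f rule: fcarrier_induct) (auto intro!: fcarrier_intros)

text \<open>A linear functional on the quotient, encoded as a linear functional on polynomials in
  all letters that vanishes on the ideal. Being a total function, it can be composed freely with
  multiplications and substitutions.\<close>

definition fk_functional :: "nat \<Rightarrow> ((nat \<times> nat, 'k::field) nc_poly \<Rightarrow> 'k) \<Rightarrow> bool"
  where "fk_functional N f \<longleftrightarrow> (\<forall>p q. f (p + q) = f p + f q) \<and>
    (\<forall>c p. f (scalar c * p) = c * f p) \<and> (\<forall>p \<in> fk_ideal N. f p = 0)"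

lemma fk_functional_gen_mult:
  "fk_functional N f \<Longrightarrow> a \<in> fk_gens N \<Longrightarrow> fk_functional N (\<lambda>q. f (gen a * q))"
  by (simp add: fk_functional_def distrib_left mult_scalar_left_commute mult_left_in_fk_ideal
      gen_in_fcarrier)

lemma fk_functional_subst:
  "fk_functional N f \<Longrightarrow> a \<in> fk_gens N \<Longrightarrow> fk_functional N (\<lambda>q. f (subst (tr a) q))"
  by (simp add: fk_functional_def tr_in_fk_ideal)

lemma coact_cancel:
  assumes "v \<in> fk_carrier N" "\<And>q. q \<in> fk_carrier N \<Longrightarrow> f q + g q = 0"
  shows "coact f v + coact g v = 0"
  using coact_eq_0[of v N "\<lambda>q. f q + g q"] assms by (simp add: coact_fun_add)

text \<open>The coaction descends to the quotient because the relations are primitive up to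
  antisymmetry. Expanding \<open>coact f (r * v)\<close> gives a term in which \<open>f\<close> sees
  a multiple of \<open>r\<close>, which is zero, a term with left factor \<open>r\<close>, which
  lies in the ideal, and mixed terms, which cancel. Left multiplication by a generator changes
  \<open>f\<close>, so the induction ranges over all functionals.\<close>

lemma coact_in_fk_ideal:
  assumes "p \<in> fk_ideal N" "fk_functional N f" shows "coact f p \<in> fk_ideal N"
  using assms
proof (induction p arbitrary: f rule: fk_ideal_induct)
  case (relation r v)
  note v = \<open>v \<in> fk_carrier N\<close>
  have add: "f (p + q) = f p + f q" and kill: "p \<in> fk_ideal N \<Longrightarrow> f p = 0" for p q
    using relation(3) by (auto simp: fk_functional_def)
  have diff: "f (p - q) = f p - f q" for p q
    using add[of "p - q" q] by simp
  have in_ideal: "r * q \<in> fk_ideal N" if "q \<in> fk_carrier N" for q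
    using that relation(1) fk_relations_in_fk_ideal by (blast intro: mult_right_in_fk_ideal)
  have kill_r: "coact (\<lambda>q. f (r * q)) v = 0"
    by (rule coact_eq_0[OF v]) (simp add: kill in_ideal)
  \<comment> \<open>The source of the cancellations: \<open>f\<close> takes opposite values on
    opposite generators times the same element.\<close>
  have pair: "f (gen (i, j) * subst (tr a) q) + f (gen (j, i) * subst (tr a) q) = 0"
    if "{i, j} \<subseteq> {1..N}" "distinct [i, j]" "a \<in> fk_gens N" "q \<in> fk_carrier N" for i j a q
    using kill[OF fk_ideal_gen_antisym[OF that(1,2) tr_in_fcarrier[OF that(3,4)]]]
    by (simp add: add)
  from relation(1) show ?case
  proof (cases rule: fk_relations_cases)
    case (antisym i j)
    let ?Z = "coact (\<lambda>q. f (subst (tr (i, j)) q)) v"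
    \<comment> \<open>A linear relation has no mixed terms; equality of the two transpositions lets
      both summands share the functional in \<open>?Z\<close>.\<close>
    have "tr (j, i) = tr (i, j)" by (simp add: transpose_commute)
    then have "coact f (r * v) = coact (\<lambda>q. f (r * q)) v + r * ?Z"
      by (simp add: antisym(1) distrib_right add coact_fun_add)
    then show ?thesis
      using v by (simp add: kill_r in_ideal coact_in_fcarrier)
  next
    case (square i j)
    let ?a = "(i, j)" and ?t = "tr (i, j)"
    have a: "?a \<in> fk_gens N" using square by (auto simp: fk_gens_def)
    have mid: "coact (\<lambda>q. f (gen ?a * subst ?t q)) v + coact (\<lambda>q. f (gen (j, i) * subst ?t q)) v = 0"
      by (rule coact_cancel[OF v]) (rule pair[OF square(2,3) a])
    \<comment> \<open>Moving the outer letter past the inner one reverses the latter to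
      \<open>(j, i)\<close>, so the mixed terms form an antisymmetric pair.\<close>
    have "coact f (r * v) = coact (\<lambda>q. f (r * q)) v +
        gen ?a * (coact (\<lambda>q. f (gen ?a * subst ?t q)) v + coact (\<lambda>q. f (gen (j, i) * subst ?t q)) v)
        + r * coact (\<lambda>q. f (subst (?t \<circ> ?t) q)) v"
      by (simp add: square(1) distrib_left mult.assoc)
    then show ?thesis
      using v unfolding mid by (simp add: kill_r in_ideal coact_in_fcarrier)
  next
    case (commute i j k m)
    let ?a = "(i, j)" and ?b = "(k, m)"
    let ?Z = "coact (\<lambda>q. f (subst (tr ?a \<circ> tr ?b) q)) v"
    \<comment> \<open>Disjoint transpositions commute and fix each other's letters. Hence the mixed
      terms of the two products agree and cancel without antisymmetry.\<close>
    have comm: "tr ?b \<circ> tr ?a = tr ?a \<circ> tr ?b"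
      using commute by (auto simp: fun_eq_iff transpose_def)
    have fixed: "tr ?a ?b = ?b" "tr ?b ?a = ?a"
      using commute by auto
    have "coact f (r * v) = coact (\<lambda>q. f (gen ?a * (gen ?b * q))) v -
        coact (\<lambda>q. f (gen ?b * (gen ?a * q))) v + r * ?Z"
      unfolding commute(1) left_diff_distrib mult.assoc coact_simps coact_gen_mult subst_gen_mult
        subst_subst comm fixed by (simp add: algebra_simps)
    moreover have "coact (\<lambda>q. f (gen ?a * (gen ?b * q))) v =
        coact (\<lambda>q. f (r * q) + f (gen ?b * (gen ?a * q))) v"
      by (simp add: commute(1) left_diff_distrib mult.assoc diff)
    ultimately have "coact f (r * v) = r * ?Z"
      by (simp add: coact_fun_add kill_r)
    then show ?thesis
      using v by (simp add: in_ideal coact_in_fcarrier)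
  next
    case (three i j k)
    let ?a = "(i, j)" and ?b = "(j, k)" and ?c = "(k, i)"
    let ?Z = "coact (\<lambda>q. f (subst (tr ?a \<circ> tr ?b) q)) v"
    have gens: "?a \<in> fk_gens N" "?b \<in> fk_gens N" "?c \<in> fk_gens N"
      using three by (auto simp: fk_gens_def)
    \<comment> \<open>The three products of transpositions are the same 3-cycle, so the final terms
      share one functional and combine to \<open>r * ?Z\<close>.\<close>
    have cyc: "tr ?b \<circ> tr ?c = tr ?a \<circ> tr ?b" "tr ?c \<circ> tr ?a = tr ?a \<circ> tr ?b"
      using three by (auto simp: fun_eq_iff transpose_def)
    \<comment> \<open>Each moved letter is the reverse of a letter of the relation. Grouped by left
      factor, the six mixed terms become three antisymmetric pairs.\<close>
    have moves: "tr ?a ?b = (i, k)" "tr ?b ?c = (j, i)" "tr ?c ?a = (k, j)"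
      using three by auto
    let ?m = "\<lambda>x t. coact (\<lambda>q. f (gen x * subst (tr t) q)) v"
    have mid: "?m (x, y) t + ?m (y, x) t = 0"
      if "t \<in> fk_gens N" "{x, y} \<subseteq> {1..N}" "distinct [x, y]" for x y t
      by (rule coact_cancel[OF v]) (rule pair[OF that(2,3,1)])
    have "?m ?a ?b + ?m (j, i) ?b = 0" "?m ?b ?c + ?m (k, j) ?c = 0" "?m ?c ?a + ?m (i, k) ?a = 0"
      by (intro mid gens; use three in simp)+
    note mid = this
    have "coact f (r * v) =
        (coact (\<lambda>q. f (gen ?a * (gen ?b * q))) v + coact (\<lambda>q. f (gen ?b * (gen ?c * q))) v +
          coact (\<lambda>q. f (gen ?c * (gen ?a * q))) v)
        + gen ?b * (?m ?a ?b + ?m (j, i) ?b) + gen ?c * (?m ?b ?c + ?m (k, j) ?c)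
        + gen ?a * (?m ?c ?a + ?m (i, k) ?a) + r * ?Z"
      unfolding three(1) distrib_right mult.assoc coact_simps coact_gen_mult subst_gen_mult
        subst_subst cyc moves by (simp add: algebra_simps)
    also have "coact (\<lambda>q. f (gen ?a * (gen ?b * q))) v + coact (\<lambda>q. f (gen ?b * (gen ?c * q))) v +
          coact (\<lambda>q. f (gen ?c * (gen ?a * q))) v = coact (\<lambda>q. f (r * q)) v"
      by (simp add: three(1) distrib_right mult.assoc add coact_fun_add)
    finally show ?thesis
      using v unfolding mid by (simp add: kill_r in_ideal coact_in_fcarrier)
  qed
next
  case (gen a p)
  then show ?case
    by (simp add: add_in_fk_ideal mult_left_in_fk_ideal gen_in_fcarrier fk_functional_gen_mult
        fk_functional_subst)
qed (simp_all add: zero_in_fk_ideal add_in_fk_ideal mult_left_in_fk_ideal scalar_in_free_algebra)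

text \<open>A functional concentrated in degree \<open>d\<close> sees only terms whose first tensor
  factor has degree \<open>d\<close>. For a word of length at most \<open>d\<close> that factor must
  use up every letter, leaving a scalar.\<close>

lemma coact_word_eq_scalar:
  assumes "\<And>u. length u \<noteq> d \<Longrightarrow> f (monom_word u) = 0" "length u \<le> d"
  shows "coact_word u f = (if length u = d then scalar (f (monom_word u)) else 0)"
  using assms
proof (induction u arbitrary: f d)
  case Nil
  then show ?case using Nil(1)[of "[]"] by (auto simp: monom_word_Nil)
next
  case (Cons a u)
  then obtain e where d: "d = Suc e" by (cases d) auto
  have "coact_word u (\<lambda>p. f (gen a * p)) =
      (if length u = e then scalar (f (gen a * monom_word u)) else 0)"
    by (rule Cons.IH) (use Cons.prems in \<open>auto simp: d simp flip: monom_word_Cons\<close>)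
  \<comment> \<open>Here one letter has gone to the second factor. As \<open>u\<close> is shorter
    than \<open>d\<close>, this contribution will vanish.\<close>
  moreover have "coact_word u (\<lambda>p. f (subst (tr a) p)) =
      (if length u = d then scalar (f (subst (tr a) (monom_word u))) else 0)"
    by (rule Cons.IH) (use Cons.prems in auto)
  ultimately show ?case
    using Cons.prems(2) by (simp add: d monom_word_Cons[of a u])
qed

text \<open>The opposite extreme: to reach degree \<open>n\<close> in the second factor, all letters
  must go there, so the first factor is 1, which every transposition fixes.\<close>

lemma hpart_coact_word:
  "length u \<le> n \<Longrightarrow>
    hpart n (coact_word u f) = (if length u = n then scalar (f 1) * monom_word u else 0)"
proof (induction u arbitrary: f n)
  case Nil
  then show ?case by (simp add: monom_word_Nil)
next
  case (Cons a u)
  then obtain m where "n = Suc m" by (cases n) auto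
  with Cons show ?case
    by (simp add: monom_word_Cons[of a u] mult_scalar_left_commute)
qed

lemma hpart_coact_hpart: "hpart n (coact f (hpart n p)) = scalar (f 1) * hpart n p"
  by (induction p rule: nc_poly_induct)
     (simp_all add: hpart_coact_word distrib_left mult_scalar_left_commute[of "scalar (f 1)"])

text \<open>The elements whose degree \<open>d\<close> part lies in the ideal form a subspace
  avoiding \<open>x\<close>. It contains the ideal, which is graded, and everything without degree
  \<open>d\<close> part. A basis of it, enlarged by \<open>x\<close>, carries a functional with
  value 1 at \<open>x\<close> and 0 on the subspace.\<close>

lemma ex_fk_functional:
  fixes x :: "(nat \<times> nat, 'k::field) nc_poly"
  assumes "hpart d x \<notin> fk_ideal N"
  obtains f where "fk_functional N f" "f x = 1" "\<And>p. hpart d p = 0 \<Longrightarrow> f p = 0"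
proof -
  let ?s = "\<lambda>c (p :: (nat \<times> nat, 'k) nc_poly). scalar c * p"
  interpret vector_space_pair ?s "(*) :: 'k \<Rightarrow> 'k \<Rightarrow> 'k"
    by standard (simp_all add: scalar_add scalar_mult algebra_simps)
  let ?P = "{p :: (nat \<times> nat, 'k) nc_poly. hpart d p \<in> fk_ideal N}"
  have P: "vs1.subspace ?P"
    by (rule vs1.subspaceI)
       (simp_all add: zero_in_fk_ideal add_in_fk_ideal mult_left_in_fk_ideal scalar_in_free_algebra)
  obtain B where B: "B \<subseteq> ?P" "vs1.independent B" "?P \<subseteq> vs1.span B"
    by (rule vs1.maximal_independent_subset)
  have "vs1.span B = ?P"
    by (rule vs1.span_subspace[OF B(1,3) P])
  then have x: "x \<notin> vs1.span B"
    using assms by simp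
  then have "vs1.independent (insert x B)"
    by (rule vs1.independent_insertI[OF _ B(2)])
  from linear_independent_extend[OF this, of "\<lambda>y. if y = x then 1 else 0"]
  obtain f where f: "Vector_Spaces.linear ?s (*) f" "f x = 1" "\<forall>y\<in>B. y \<noteq> x \<longrightarrow> f y = 0"
    by auto
  interpret f: Vector_Spaces.linear ?s "(*)" f by fact
  have "f y = 0" if "y \<in> B" for y
    using f(3) that x vs1.span_base by metis
  then have zero: "f p = 0" if "p \<in> ?P" for p
    using f.eq_0_on_span[of B p] that B(3) by auto
  have "fk_functional N f"
    unfolding fk_functional_def
    by (auto simp: f.add f.scale intro!: zero hpart_in_fk_ideal)
  moreover have "f p = 0" if "hpart d p = 0" for p
    using that by (intro zero) (simp add: zero_in_fk_ideal)
  ultimately show thesis using f(2) that by blast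
qed

text \<open>Modulo the ideal, every element has the form \<open>coact f x\<close>: this holds for
  scalars and is preserved by sums and by left multiplication with generators. Top degree enters
  only through the assumption that generators annihilate \<open>x\<close>.\<close>

lemma fk_annihilated_unique:
  fixes x :: "(nat \<times> nat, 'k::field) nc_poly"
  assumes x: "x \<in> fk_carrier N" "hpart d x = x" "x \<notin> fk_ideal N"
    and ann: "\<And>a. a \<in> fk_gens N \<Longrightarrow> gen a * x \<in> fk_ideal N"
    and y: "y \<in> fk_carrier N" "hpart d y = y"
  obtains c where "y - scalar c * x \<in> fk_ideal N"
proof -
  have "\<exists>f. fk_functional N f \<and> p - coact f x \<in> fk_ideal N" if "p \<in> fk_carrier N" for p
    using that
  proof (induction p rule: fcarrier_induct)
    case (scalar c)
    obtain f where f: "fk_functional N f" "f x = 1" "\<And>p. hpart d p = 0 \<Longrightarrow> f p = 0"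
      using ex_fk_functional[of d x N] x by metis
    have lin: "f 0 = 0" "f (p + q) = f p + f q" "f (scalar c * p) = c * f p" for p q c
      using f(1,3) by (auto simp: fk_functional_def)
    \<comment> \<open>Since \<open>x\<close> equals its degree \<open>d\<close> part, this yields
      \<open>coact f x = 1\<close>.\<close>
    have "coact f (hpart d p) = scalar (f (hpart d p))" for p
      by (induction p rule: nc_poly_induct)
         (simp_all add: lin scalar_add scalar_mult coact_word_eq_scalar[of d f] f(3))
    then have "coact f x = 1"
      by (metis x(2) f(2) scalar_1)
    then have "scalar c - coact (\<lambda>q. c * f q) x = 0"
      by (simp add: coact_fun_scalar)
    moreover have "fk_functional N (\<lambda>q. c * f q)"
      using f(1) by (simp add: fk_functional_def algebra_simps)
    ultimately show ?case
      by (metis zero_in_fk_ideal)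
  next
    case (gen a p)
    then obtain f where f: "fk_functional N f" "p - coact f x \<in> fk_ideal N" by blast
    \<comment> \<open>The transposition is an involution, so the twist of \<open>?g\<close> is
      \<open>f\<close> again. The expansion of \<open>coact ?g (gen a * x)\<close>, which lies in
      the ideal, then expresses \<open>gen a * coact f x\<close> as minus the coaction of a
      translate of \<open>?g\<close>.\<close>
    let ?g = "\<lambda>q. f (subst (tr a) q)"
    have g: "fk_functional N ?g" by (rule fk_functional_subst[OF f(1) gen(1)])
    have "subst (tr a) (subst (tr a) q) = q" for q :: "(nat \<times> nat, 'k) nc_poly"
      unfolding subst_subst by (rule subst_id) (simp add: map_prod_def split: prod.split)
    then have "(\<lambda>q. ?g (subst (tr a) q)) = f"
      by (simp only:)
    then have "coact ?g (gen a * x) = coact (\<lambda>q. ?g (gen a * q)) x + gen a * coact f x"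
      by (simp only: coact_gen_mult)
    then have "gen a * p - coact (\<lambda>q. - 1 * ?g (gen a * q)) x =
        gen a * (p - coact f x) + coact ?g (gen a * x)"
      unfolding coact_fun_scalar by (simp add: scalar_uminus algebra_simps)
    also have "\<dots> \<in> fk_ideal N"
      using f(2) gen(1) by (intro add_in_fk_ideal mult_left_in_fk_ideal gen_in_fcarrier
          coact_in_fk_ideal[OF ann g])
    finally have "gen a * p - coact (\<lambda>q. - 1 * ?g (gen a * q)) x \<in> fk_ideal N" .
    moreover have "fk_functional N (\<lambda>q. - 1 * ?g (gen a * q))"
      using fk_functional_gen_mult[OF g gen(1)] by (simp add: fk_functional_def)
    ultimately show ?case by blast
  next
    case (add p q)
    then obtain f g where fg: "fk_functional N f" "p - coact f x \<in> fk_ideal N"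
      "fk_functional N g" "q - coact g x \<in> fk_ideal N" by blast
    have "p + q - coact (\<lambda>q. f q + g q) x = (p - coact f x) + (q - coact g x)"
      by (simp add: coact_fun_add)
    with fg have "p + q - coact (\<lambda>q. f q + g q) x \<in> fk_ideal N"
      by (metis add_in_fk_ideal)
    moreover have "fk_functional N (\<lambda>q. f q + g q)"
      using fg by (simp add: fk_functional_def algebra_simps)
    ultimately show ?case by blast
  qed
  then obtain f where "y - coact f x \<in> fk_ideal N" using y(1) by blast
  then have "hpart d (y - coact f x) \<in> fk_ideal N" by (rule hpart_in_fk_ideal)
  \<comment> \<open>In degree \<open>d\<close> only the term with first factor 1 survives, so the
    required constant is \<open>f 1\<close>.\<close>
  moreover have "hpart d (coact f x) = scalar (f 1) * x"
    using hpart_coact_hpart[of d f x] x(2) by simp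
  ultimately have "y - scalar (f 1) * x \<in> fk_ideal N"
    using y(2) by simp
  then show thesis by (rule that)
qed

section \<open>The top component\<close>

lemma ex_hpart_bound: "\<exists>D. \<forall>e>D. hpart e p = 0"
proof (induction p rule: nc_poly_induct)
  case (monom c u)
  show ?case by (rule exI[of _ "length u"]) simp
next
  case (add p q)
  then obtain D E where "\<forall>e>D. hpart e p = 0" "\<forall>e>E. hpart e q = 0" by blast
  then show ?case by (intro exI[of _ "max D E"]) simp
qed simp

section \<open>Translation between polynomials and the quotient ring\<close>

lemma fk_proj_eq_iff:
  fixes p q :: "(nat \<times> nat, 'k::field) nc_poly"
  assumes "p \<in> fk_carrier N" "q \<in> fk_carrier N"
  shows "fk_proj N p = fk_proj N q \<longleftrightarrow> p - q \<in> fk_ideal N"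
proof -
  interpret F: ring "free_algebra (fk_gens N)" by (rule ring_free_algebra)
  have "\<ominus>\<^bsub>free_algebra (fk_gens N)\<^esub> q = - q"
    using assms(2) diff_in_fcarrier[OF zero_in_fcarrier assms(2)]
    by (intro F.minus_equality) (simp_all add: free_algebra_def)
  then have "p \<ominus>\<^bsub>free_algebra (fk_gens N)\<^esub> q = p - q"
    unfolding F.minus_eq by (simp add: free_algebra_def)
  then show ?thesis
    unfolding fk_proj_def using F.quotient_eq_iff_same_a_r_cos[OF ideal_fk_ideal assms] by simp
qed

lemma carrier_FK: "carrier (FK N) = fk_proj N ` fk_carrier N"
  by (simp add: FK_def fk_proj_def FactRing_def A_RCOSETS_def' UNION_singleton_eq_range)

lemma fk_proj_ops:
  fixes p q :: "(nat \<times> nat, 'k::field) nc_poly"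
  assumes "p \<in> fk_carrier N" "q \<in> fk_carrier N"
  shows "fk_proj N p \<oplus>\<^bsub>FK N\<^esub> fk_proj N q = fk_proj N (p + q)"
    and "fk_proj N p \<otimes>\<^bsub>FK N\<^esub> fk_proj N q = fk_proj N (p * q)"
  using ring_hom_add[OF ring_hom_ring.homh[OF fk_proj_hom] assms]
    ring_hom_mult[OF ring_hom_ring.homh[OF fk_proj_hom] assms]
  by (simp_all add: free_algebra_def)

lemma zero_FK: "\<zero>\<^bsub>FK N\<^esub> = fk_proj N (0 :: (nat \<times> nat, 'k::field) nc_poly)"
proof -
  have "fk_proj N \<zero>\<^bsub>free_algebra (fk_gens N)\<^esub> = (\<zero>\<^bsub>FK N\<^esub> :: (nat \<times> nat, 'k) nc_poly set)"
    by (rule ring_hom_zero[OF ring_hom_ring.homh[OF fk_proj_hom] ring_free_algebra ring_FK])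
  then show ?thesis by (simp add: free_algebra_def)
qed

lemma fk_component_eq: "fk_component N d = fk_proj N ` {p \<in> fk_carrier N. hpart d p = p}"
  by (simp add: fk_component_def homogeneous_iff_hpart)

text \<open>A component always contains zero, so its triviality is a condition on homogeneous
  representatives alone.\<close>

lemma fk_component_eq_zero_iff:
  "fk_component N d = ({\<zero>\<^bsub>FK N\<^esub>} :: (nat \<times> nat, 'k::field) nc_poly set set) \<longleftrightarrow>
    (\<forall>p \<in> (fk_carrier N :: (nat \<times> nat, 'k) nc_poly set). hpart d p = p \<longrightarrow> p \<in> fk_ideal N)"
proof -
  have "fk_proj N p = \<zero>\<^bsub>FK N\<^esub> \<longleftrightarrow> p \<in> fk_ideal N"
    if "p \<in> fk_carrier N" for p :: "(nat \<times> nat, 'k) nc_poly"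
    using fk_proj_eq_iff[OF that zero_in_fcarrier] by (simp add: zero_FK)
  moreover have "(\<zero>\<^bsub>FK N\<^esub> :: (nat \<times> nat, 'k) nc_poly set) \<in> fk_component N d"
    by (auto simp: zero_FK fk_component_eq intro!: imageI zero_in_fcarrier)
  then have "fk_component N d = ({\<zero>\<^bsub>FK N\<^esub>} :: (nat \<times> nat, 'k) nc_poly set set) \<longleftrightarrow>
      (\<forall>y \<in> fk_component N d. y = (\<zero>\<^bsub>FK N\<^esub> :: (nat \<times> nat, 'k) nc_poly set))"
    by auto
  ultimately show ?thesis
    by (simp add: fk_component_eq) blast
qed

text \<open>Scalar multiples do not raise the degree of a representative, and a sum needs at most
  the larger of two bounds.\<close>

lemma Span_FK_bounded:
  fixes Us :: "(nat \<times> nat, 'k::field) nc_poly set list"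
  assumes "set Us \<subseteq> carrier (FK N)"
  shows "\<exists>D. ring.Span (FK N) (fk_scalars N) Us \<subseteq>
    fk_proj N ` {p \<in> fk_carrier N. \<forall>e>D. hpart e p = 0}"
  using assms
proof (induction Us)
  interpret FK: ring "FK N :: (nat \<times> nat, 'k) nc_poly set ring" by (rule ring_FK)
  case Nil
  then show ?case by (auto simp: zero_FK intro!: imageI zero_in_fcarrier)
next
  interpret FK: ring "FK N :: (nat \<times> nat, 'k) nc_poly set ring" by (rule ring_FK)
  case (Cons u Us)
  let ?B = "\<lambda>D. {p \<in> fk_carrier N. \<forall>e>D. hpart e p = 0}"
  obtain D where D: "FK.Span (fk_scalars N) Us \<subseteq> fk_proj N ` ?B D" using Cons by auto
  obtain q where q: "q \<in> fk_carrier N" "u = fk_proj N q" using Cons.prems by (auto simp: carrier_FK)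
  obtain E where E: "\<forall>e>E. hpart e q = 0" using ex_hpart_bound[of q] by blast
  have "FK.Span (fk_scalars N) (u # Us) \<subseteq> fk_proj N ` ?B (max D E)"
  proof
    fix x assume "x \<in> FK.Span (fk_scalars N) (u # Us)"
    then obtain k v where kv: "k \<in> fk_scalars N" "v \<in> FK.Span (fk_scalars N) Us"
      "x = k \<otimes>\<^bsub>FK N\<^esub> u \<oplus>\<^bsub>FK N\<^esub> v"
      by (auto simp: FK.line_extension_mem_iff)
    from kv(1) obtain c where c: "k = fk_proj N (scalar c)" by (auto simp: fk_scalars_def)
    from kv(2) D obtain p where p: "p \<in> ?B D" "v = fk_proj N p" by auto
    have "x = fk_proj N (scalar c * q + p)"
      using kv(3) c p q by (simp add: fk_proj_ops fcarrier_intros)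
    moreover have "scalar c * q + p \<in> ?B (max D E)"
      using p(1) q(1) E by (auto intro!: fcarrier_intros)
    ultimately show "x \<in> fk_proj N ` ?B (max D E)" by blast
  qed
  then show ?case by blast
qed

text \<open>A finite basis bounds the degrees needed to represent any class; since the ideal is
  graded, a homogeneous element beyond that bound must be zero in the quotient.\<close>

lemma fk_component_eventually_zero:
  assumes "ring.finite_dimension (FK N :: (nat \<times> nat, 'k::field) nc_poly set ring) (fk_scalars N) (carrier (FK N))"
  shows "\<exists>D. \<forall>e>D. fk_component N e = ({\<zero>\<^bsub>FK N\<^esub>} :: (nat \<times> nat, 'k) nc_poly set set)"
proof -
  interpret FK: ring "FK N :: (nat \<times> nat, 'k) nc_poly set ring" by (rule ring_FK)
  obtain n where "FK.dimension n (fk_scalars N) (carrier (FK N))"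
    using assms by (auto simp: FK.finite_dimension_def)
  from FK.exists_base[OF subfield_fk_scalars this] obtain Us
    where "set Us \<subseteq> carrier (FK N)" "FK.Span (fk_scalars N) Us = carrier (FK N)" by blast
  with Span_FK_bounded[of Us N] obtain D
    where D: "(carrier (FK N) :: (nat \<times> nat, 'k) nc_poly set set) \<subseteq> fk_proj N ` {p \<in> fk_carrier N. \<forall>e>D. hpart e p = 0}" by auto
  have "p \<in> fk_ideal N" if "e > D" "p \<in> fk_carrier N" "hpart e p = p"
    for e and p :: "(nat \<times> nat, 'k) nc_poly"
  proof -
    have "fk_proj N p \<in> carrier (FK N)" using that(2) by (simp add: carrier_FK)
    then obtain q where q: "fk_proj N p = fk_proj N q" "q \<in> fk_carrier N" "\<forall>e>D. hpart e q = 0"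
      using D by auto
    then have "p - q \<in> fk_ideal N" using fk_proj_eq_iff that(2) by blast
    \<comment> \<open>The part of \<open>q\<close> in degree \<open>e\<close> is zero, so projecting
      the congruence leaves \<open>p\<close> itself.\<close>
    then have "hpart e (p - q) \<in> fk_ideal N" by (rule hpart_in_fk_ideal)
    then show ?thesis using that q(3) by simp
  qed
  then show ?thesis
    by (intro exI[of _ D]) (simp add: fk_component_eq_zero_iff)
qed

theorem corollary6p2:
  fixes N :: nat
  assumes "N \<ge> 2"
    and "ring.finite_dimension (FK N :: (nat \<times> nat, 'k::field_char_0) nc_poly set ring)
           (fk_scalars N) (carrier (FK N))"
  shows "\<exists>d. (fk_component N d :: (nat \<times> nat, 'k) nc_poly set set) \<noteq> {\<zero>\<^bsub>FK N\<^esub>}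
           \<and> (\<forall>e>d. (fk_component N e :: (nat \<times> nat, 'k) nc_poly set set) = {\<zero>\<^bsub>FK N\<^esub>})
           \<and> ring.dimension (FK N :: (nat \<times> nat, 'k) nc_poly set ring) 1
               (fk_scalars N) (fk_component N d)"
proof -
  interpret FK: ring "FK N :: (nat \<times> nat, 'k) nc_poly set ring" by (rule ring_FK)
  let ?nz = "\<lambda>d. (fk_component N d :: (nat \<times> nat, 'k) nc_poly set set) \<noteq> {\<zero>\<^bsub>FK N\<^esub>}"
  obtain D where D: "\<And>e. ?nz e \<Longrightarrow> e \<le> D"
    using fk_component_eventually_zero[OF assms(2)] by (meson not_le)
  \<comment> \<open>The class of 1 is nonzero in degree 0, which together with the bound
    \<open>D\<close> ensures that a greatest nonzero degree exists.\<close>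
  have "hpart 0 (1 :: (nat \<times> nat, 'k) nc_poly) = 1"
    using hpart_simps(6)[of 0 1] by simp
  then have "?nz 0"
    unfolding fk_component_eq_zero_iff using one_notin_fk_ideal one_in_fcarrier by blast
  define d where "d = (GREATEST d. ?nz d)"
  have nz: "?nz d"
    unfolding d_def by (rule GreatestI_nat[of ?nz 0 D, OF \<open>?nz 0\<close> D])
  have top: "fk_component N e = ({\<zero>\<^bsub>FK N\<^esub>} :: (nat \<times> nat, 'k) nc_poly set set)" if "e > d" for e
    using Greatest_le_nat[of ?nz e D, OF _ D] that unfolding d_def by (meson not_le)
  from nz obtain x :: "(nat \<times> nat, 'k) nc_poly"
    where x: "x \<in> fk_carrier N" "hpart d x = x" "x \<notin> fk_ideal N"
    unfolding fk_component_eq_zero_iff by blast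
  \<comment> \<open>The product has degree one above the top, where the component vanishes.\<close>
  have ann: "gen a * x \<in> fk_ideal N" if "a \<in> fk_gens N" for a
  proof -
    have "hpart (Suc d) (gen a * x) = gen a * x" using x(2) by simp
    moreover have "gen a * x \<in> fk_carrier N"
      using that x(1) by (intro mult_in_fcarrier gen_in_fcarrier)
    ultimately show ?thesis
      using top[of "Suc d"] unfolding fk_component_eq_zero_iff by blast
  qed
  \<comment> \<open>Writing the component as a line added to the zero space makes its dimension one
    more than zero once the class of \<open>x\<close> is known to be nonzero.\<close>
  have "fk_component N d = FK.line_extension (fk_scalars N) (fk_proj N x) {\<zero>\<^bsub>FK N\<^esub>}"
  proof (rule Set.set_eqI, rule iffI)
    fix y :: "(nat \<times> nat, 'k) nc_poly set" assume "y \<in> fk_component N d"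
    then obtain p where p: "p \<in> fk_carrier N" "hpart d p = p" "y = fk_proj N p"
      unfolding fk_component_eq by blast
    obtain c where "p - scalar c * x \<in> fk_ideal N"
      using fk_annihilated_unique[OF x ann p(1,2)] by blast
    then have "y = fk_proj N (scalar c * x)"
      using p x(1) fk_proj_eq_iff[of p N "scalar c * x"] by (simp add: fcarrier_intros)
    also have "\<dots> = fk_proj N (scalar c) \<otimes>\<^bsub>FK N\<^esub> fk_proj N x \<oplus>\<^bsub>FK N\<^esub> \<zero>\<^bsub>FK N\<^esub>"
      using x(1) by (simp add: zero_FK fk_proj_ops fcarrier_intros)
    finally show "y \<in> FK.line_extension (fk_scalars N) (fk_proj N x) {\<zero>\<^bsub>FK N\<^esub>}"
      unfolding FK.line_extension_mem_iff fk_scalars_def by blast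
  next
    fix y :: "(nat \<times> nat, 'k) nc_poly set" assume "y \<in> FK.line_extension (fk_scalars N) (fk_proj N x) {\<zero>\<^bsub>FK N\<^esub>}"
    then obtain c where
      "y = fk_proj N (scalar c) \<otimes>\<^bsub>FK N\<^esub> fk_proj N x \<oplus>\<^bsub>FK N\<^esub> \<zero>\<^bsub>FK N\<^esub>"
      unfolding FK.line_extension_mem_iff fk_scalars_def by blast
    then have "y = fk_proj N (scalar c * x)"
      using x(1) by (simp add: zero_FK fk_proj_ops fcarrier_intros)
    then show "y \<in> fk_component N d"
      unfolding fk_component_eq using x by (simp add: mult_in_fcarrier scalar_in_free_algebra)
  qed
  moreover have "FK.dimension (Suc 0) (fk_scalars N)
      (FK.line_extension (fk_scalars N) (fk_proj N x) {\<zero>\<^bsub>FK N\<^esub>})"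
  proof (rule FK.Suc_dim)
    show "fk_proj N x \<in> carrier (FK N)" using x(1) by (simp add: carrier_FK)
    show "fk_proj N x \<notin> {\<zero>\<^bsub>FK N\<^esub>}"
      using x fk_proj_eq_iff[OF x(1) zero_in_fcarrier] by (simp add: zero_FK)
  qed simp
  ultimately have "FK.dimension 1 (fk_scalars N) (fk_component N d)" by simp
  with nz top show ?thesis by blast
qed

end
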